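(* Let $n\ge2$ and $-n\le p<0$. In $\mathbb{R}^n$ with density $r^p$, isoperimetric regions do not exist: any positive weighted volume can be enclosed with arbitrarily small weighted perimeter.
   Context: $r=|x|$. Density $r^p$ means that weighted volume is $\int r^p\,dV_0$ and weighted perimeter is $\int_{\partial} r^p\,dA_0$, with $dV_0$, $dA_0$ Euclidean volume and hypersurface area. A region is isoperimetric if it has least weighted perimeter among regions with the same weighted volume. *)

theory Defs
  imports "HOL-Analysis.Analysis"
begin

section \<open>Hausdorff measure\<close>

text \<open>
  The library has no Hausdorff measure. The normalisation is the standard one, under which the
  \<open>k\<close>-dimensional measure of a \<open>k\<close>-dimensional Euclidean unit ball is \<^term>\<open>unit_ball_vol (real k)\<close>;
  for \<open>k = n - 1\<close> it is Euclidean hypersurface area in dimension \<open>n\<close>.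
  The empty set is separated out because \<open>0 ^ 0 = 1\<close>.
\<close>

definition hausdorff_gauge :: "nat \<Rightarrow> 'a::metric_space set \<Rightarrow> ennreal" where
  "hausdorff_gauge k U =
     (if U = {} then 0 else ennreal (unit_ball_vol (real k) * (diameter U / 2) ^ k))"

text \<open>Boundedness is required explicitly: \<^const>\<open>diameter\<close> is unspecified on unbounded sets.\<close>

definition hausdorff_cover :: "real \<Rightarrow> 'a::metric_space set \<Rightarrow> (nat \<Rightarrow> 'a set) \<Rightarrow> bool" where
  "hausdorff_cover \<delta> A U \<longleftrightarrow> A \<subseteq> (\<Union>i. U i) \<and> (\<forall>i. bounded (U i) \<and> diameter (U i) \<le> \<delta>)"

definition hausdorff_premeasure :: "nat \<Rightarrow> real \<Rightarrow> 'a::metric_space set \<Rightarrow> ennreal" where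
  "hausdorff_premeasure k \<delta> A = (INF U\<in>{U. hausdorff_cover \<delta> A U}. \<Sum>i. hausdorff_gauge k (U i))"

definition hausdorff_outer_measure :: "nat \<Rightarrow> 'a::metric_space set \<Rightarrow> ennreal" where
  "hausdorff_outer_measure k A = (SUP \<delta>\<in>{0<..}. hausdorff_premeasure k \<delta> A)"

text \<open>
  \<^const>\<open>measure_of\<close> collapses to the zero measure if its argument is not a measure; that this does
  not happen here is \<open>emeasure_hausdorff_measure\<close> below.
\<close>

definition hausdorff_measure :: "nat \<Rightarrow> 'a::metric_space measure" where
  "hausdorff_measure k = measure_of UNIV (sets borel) (hausdorff_outer_measure k)"

lemma hausdorff_gauge_empty [simp]: "hausdorff_gauge k {} = 0"
  by (simp add: hausdorff_gauge_def)

lemma hausdorff_gauge_mono: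
  assumes "U \<subseteq> V" "bounded V"
  shows "hausdorff_gauge k U \<le> hausdorff_gauge k V"
proof -
  have "0 \<le> diameter U"
    using assms bounded_subset diameter_ge_0 by blast
  then show ?thesis
    using diameter_subset[OF assms] assms
    by (auto simp: hausdorff_gauge_def intro!: ennreal_leI mult_left_mono power_mono)
qed

lemma hausdorff_cover_subset: "hausdorff_cover \<delta> B U \<Longrightarrow> A \<subseteq> B \<Longrightarrow> hausdorff_cover \<delta> A U"
  by (auto simp: hausdorff_cover_def)

lemma hausdorff_premeasure_mono: "A \<subseteq> B \<Longrightarrow> hausdorff_premeasure k \<delta> A \<le> hausdorff_premeasure k \<delta> B"
  unfolding hausdorff_premeasure_def
  by (rule INF_superset_mono) (auto intro: hausdorff_cover_subset)

lemma hausdorff_premeasure_empty: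
  assumes "0 < \<delta>"
  shows "hausdorff_premeasure k \<delta> ({} :: 'a::metric_space set) = 0"
proof -
  have "hausdorff_cover \<delta> ({} :: 'a set) (\<lambda>_. {})"
    using assms by (auto simp: hausdorff_cover_def)
  then have "hausdorff_premeasure k \<delta> ({} :: 'a set) \<le> (\<Sum>i::nat. hausdorff_gauge k ({} :: 'a set))"
    unfolding hausdorff_premeasure_def by (intro INF_lower) auto
  then show ?thesis
    by simp
qed

lemma hausdorff_premeasure_subadditive:
  fixes A :: "nat \<Rightarrow> 'a::metric_space set"
  shows "hausdorff_premeasure k \<delta> (\<Union>i. A i) \<le> (\<Sum>i. hausdorff_premeasure k \<delta> (A i))"
proof (rule ennreal_le_epsilon)
  fix e :: real
  assume fin: "(\<Sum>i. hausdorff_premeasure k \<delta> (A i)) < top" and e: "0 < e"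
  have "\<exists>U. hausdorff_cover \<delta> (A i) U \<and>
      (\<Sum>j. hausdorff_gauge k (U j)) \<le> hausdorff_premeasure k \<delta> (A i) + ennreal (e * (1/2)^Suc i)" for i
  proof -
    have "hausdorff_premeasure k \<delta> (A i) < top"
      using fin by (rule ennreal_suminf_lessD)
    then have "hausdorff_premeasure k \<delta> (A i) < hausdorff_premeasure k \<delta> (A i) + ennreal (e * (1/2)^Suc i)"
      using e ennreal_add_left_cancel_less[of "hausdorff_premeasure k \<delta> (A i)" 0 "ennreal (e * (1/2)^Suc i)"]
      by simp
    then show ?thesis
      by (subst (asm) (1) hausdorff_premeasure_def) (auto simp: INF_less_iff intro: less_imp_le)
  qed
  then obtain U where cov: "\<And>i. hausdorff_cover \<delta> (A i) (U i)"
    and le: "\<And>i. (\<Sum>j. hausdorff_gauge k (U i j)) \<le> hausdorff_premeasure k \<delta> (A i) + ennreal (e * (1/2)^Suc i)"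
    by metis
  define W where "W m = (case prod_decode m of (i, j) \<Rightarrow> U i j)" for m
  have "x \<in> (\<Union>m. W m)" if x: "x \<in> A i" for x i
  proof -
    obtain j where "x \<in> U i j"
      using cov[of i] x by (auto simp: hausdorff_cover_def)
    then have "x \<in> W (prod_encode (i, j))"
      by (simp add: W_def)
    then show ?thesis
      by blast
  qed
  then have "hausdorff_cover \<delta> (\<Union>i. A i) W"
    using cov by (auto simp: hausdorff_cover_def W_def split: prod.split)
  then have "hausdorff_premeasure k \<delta> (\<Union>i. A i) \<le> (\<Sum>m. hausdorff_gauge k (W m))"
    unfolding hausdorff_premeasure_def by (intro INF_lower) auto
  also have "\<dots> = (\<Sum>i. \<Sum>j. hausdorff_gauge k (U i j))"
  proof -
    have "(\<Sum>m. case_prod (\<lambda>i j. hausdorff_gauge k (U i j)) (prod_decode m)) = (\<Sum>i. \<Sum>j. hausdorff_gauge k (U i j))"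
      using suminf_ennreal_2dimen[of "\<lambda>i. \<Sum>j. hausdorff_gauge k (U i j)" "\<lambda>(i, j). hausdorff_gauge k (U i j)"]
      by (simp add: o_def)
    then show ?thesis
      by (simp add: W_def case_prod_beta)
  qed
  also have "\<dots> \<le> (\<Sum>i. hausdorff_premeasure k \<delta> (A i) + ennreal (e * (1/2)^Suc i))"
    by (intro suminf_le le) auto
  also have "\<dots> = (\<Sum>i. hausdorff_premeasure k \<delta> (A i)) + (\<Sum>i. ennreal (e * (1/2)^Suc i))"
    by (intro suminf_add[symmetric]) auto
  also have "(\<Sum>i. ennreal (e * (1/2)^Suc i)) = ennreal e"
  proof (rule suminf_ennreal_eq)
    show "(\<lambda>i. e * (1/2)^Suc i) sums e"
      using sums_mult[OF power_half_series, of e] by simp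
  qed (use e in auto)
  finally show "hausdorff_premeasure k \<delta> (\<Union>i. A i) \<le> (\<Sum>i. hausdorff_premeasure k \<delta> (A i)) + ennreal e" .
qed

lemma hausdorff_outer_measure_mono:
  "A \<subseteq> B \<Longrightarrow> hausdorff_outer_measure k A \<le> hausdorff_outer_measure k B"
  unfolding hausdorff_outer_measure_def by (intro SUP_mono' hausdorff_premeasure_mono)

lemma hausdorff_outer_measure_empty [simp]: "hausdorff_outer_measure k {} = 0"
  by (simp add: hausdorff_outer_measure_def hausdorff_premeasure_empty)

lemma hausdorff_outer_measure_countable_subadditive:
  "hausdorff_outer_measure k (\<Union>i::nat. A i) \<le> (\<Sum>i. hausdorff_outer_measure k (A i))"
  unfolding hausdorff_outer_measure_def[of k "\<Union>i. A i"]
proof (rule SUP_least)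
  fix \<delta> :: real assume "\<delta> \<in> {0<..}"
  then have "hausdorff_premeasure k \<delta> (A i) \<le> hausdorff_outer_measure k (A i)" for i
    unfolding hausdorff_outer_measure_def by (rule SUP_upper)
  then show "hausdorff_premeasure k \<delta> (\<Union>i. A i) \<le> (\<Sum>i. hausdorff_outer_measure k (A i))"
    by (intro order_trans[OF hausdorff_premeasure_subadditive] suminf_le) auto
qed

lemma outer_measure_space_hausdorff:
  "outer_measure_space UNIV (hausdorff_outer_measure k)"
  by (auto simp: outer_measure_space_def positive_def increasing_def countably_subadditive_def
      intro: hausdorff_outer_measure_mono hausdorff_outer_measure_countable_subadditive)

lemma hausdorff_outer_measure_subadditive:
  "hausdorff_outer_measure k (A \<union> B) \<le> hausdorff_outer_measure k A + hausdorff_outer_measure k B"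
proof -
  have "hausdorff_outer_measure k (\<Union>i::nat. (if i = 0 then A else if i = 1 then B else {}))
      \<le> (\<Sum>i::nat. hausdorff_outer_measure k (if i = 0 then A else if i = 1 then B else {}))"
    using hausdorff_outer_measure_countable_subadditive[of k "\<lambda>i::nat. if i = 0 then A else if i = 1 then B else {}"]
    by simp
  also have "\<dots> = (\<Sum>i\<in>{0, 1::nat}. hausdorff_outer_measure k (if i = 0 then A else if i = 1 then B else {}))"
    by (rule suminf_finite) auto
  also have "\<dots> = hausdorff_outer_measure k A + hausdorff_outer_measure k B"
    by simp
  also have "(\<Union>i::nat. (if i = 0 then A else if i = 1 then B else {})) = A \<union> B"
    by (auto split: if_splits)
  finally show ?thesis .
qed

lemma hausdorff_cover_mono: "hausdorff_cover \<delta> A U \<Longrightarrow> \<delta> \<le> \<delta>' \<Longrightarrow> hausdorff_cover \<delta>' A U"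
  unfolding hausdorff_cover_def by (meson order_trans)

lemma hausdorff_premeasure_antimono:
  "\<delta> \<le> \<delta>' \<Longrightarrow> hausdorff_premeasure k \<delta>' A \<le> hausdorff_premeasure k \<delta> A"
  unfolding hausdorff_premeasure_def
  by (rule INF_superset_mono) (auto intro: hausdorff_cover_mono)

lemma hausdorff_premeasure_separated:
  assumes sep: "\<And>x y. x \<in> A \<Longrightarrow> y \<in> B \<Longrightarrow> e \<le> dist x y" and \<delta>: "\<delta> < e"
  shows "hausdorff_premeasure k \<delta> A + hausdorff_premeasure k \<delta> B \<le> hausdorff_premeasure k \<delta> (A \<union> B)"
  unfolding hausdorff_premeasure_def[of k \<delta> "A \<union> B"]
proof (rule INF_greatest)
  fix U :: "nat \<Rightarrow> 'a set" assume "U \<in> {U. hausdorff_cover \<delta> (A \<union> B) U}"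
  then have U: "A \<union> B \<subseteq> (\<Union>i. U i)" "\<And>i. bounded (U i)" "\<And>i. diameter (U i) \<le> \<delta>"
    by (auto simp: hausdorff_cover_def)
  have nonneg: "0 \<le> \<delta>"
    using diameter_ge_0[OF U(2)[of 0]] U(3)[of 0] by linarith
  define P where "P S i = (if U i \<inter> S = {} then {} else U i)" for S i
  have cov: "hausdorff_cover \<delta> S (P S)" if "S \<subseteq> A \<union> B" for S
    using that U nonneg by (auto simp: hausdorff_cover_def P_def; blast)
  have "U i \<inter> A = {} \<or> U i \<inter> B = {}" for i
  proof (rule ccontr)
    assume "\<not> ?thesis"
    then obtain x y where xy: "x \<in> U i" "x \<in> A" "y \<in> U i" "y \<in> B"
      by blast
    then have "e \<le> diameter (U i)"
      using sep[of x y] diameter_bounded_bound[OF U(2)[of i], of x y] by linarith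
    with U(3)[of i] \<delta> show False
      by linarith
  qed
  then have le: "hausdorff_gauge k (P A i) + hausdorff_gauge k (P B i) \<le> hausdorff_gauge k (U i)" for i
    by (auto simp: P_def)
  have "hausdorff_premeasure k \<delta> A + hausdorff_premeasure k \<delta> B
      \<le> (\<Sum>i. hausdorff_gauge k (P A i)) + (\<Sum>i. hausdorff_gauge k (P B i))"
    unfolding hausdorff_premeasure_def by (intro add_mono INF_lower) (auto intro: cov)
  also have "\<dots> = (\<Sum>i. hausdorff_gauge k (P A i) + hausdorff_gauge k (P B i))"
    by (intro suminf_add) auto
  also have "\<dots> \<le> (\<Sum>i. hausdorff_gauge k (U i))"
    by (intro suminf_le le) auto
  finally show "hausdorff_premeasure k \<delta> A + hausdorff_premeasure k \<delta> B \<le> (\<Sum>i. hausdorff_gauge k (U i))" .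
qed

lemma hausdorff_outer_measure_separated:
  assumes sep: "\<And>x y. x \<in> A \<Longrightarrow> y \<in> B \<Longrightarrow> e \<le> dist x y" and e: "0 < e"
  shows "hausdorff_outer_measure k A + hausdorff_outer_measure k B \<le> hausdorff_outer_measure k (A \<union> B)"
proof -
  have "hausdorff_outer_measure k A + hausdorff_outer_measure k B
      = (SUP \<delta>\<in>{0<..}. hausdorff_premeasure k \<delta> A + hausdorff_premeasure k \<delta> B)"
    unfolding hausdorff_outer_measure_def
  proof (rule SUP_add_directed_ennreal[symmetric])
    fix i j :: real assume "i \<in> {0<..}" "j \<in> {0<..}"
    then show "\<exists>l\<in>{0<..}. hausdorff_premeasure k i A + hausdorff_premeasure k j B
        \<le> hausdorff_premeasure k l A + hausdorff_premeasure k l B"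
      by (intro bexI[of _ "min i j"] add_mono hausdorff_premeasure_antimono) auto
  qed
  also have "\<dots> \<le> hausdorff_outer_measure k (A \<union> B)"
  proof (rule SUP_least)
    fix \<delta> :: real assume \<delta>: "\<delta> \<in> {0<..}"
    define d where "d = min \<delta> (e / 2)"
    have d: "0 < d" "d < e" "d \<le> \<delta>"
      using \<delta> e by (auto simp: d_def)
    have "hausdorff_premeasure k \<delta> A + hausdorff_premeasure k \<delta> B
        \<le> hausdorff_premeasure k d A + hausdorff_premeasure k d B"
      by (intro add_mono hausdorff_premeasure_antimono d)
    also have "\<dots> \<le> hausdorff_premeasure k d (A \<union> B)"
      using sep d(2) by (rule hausdorff_premeasure_separated)
    also have "\<dots> \<le> hausdorff_outer_measure k (A \<union> B)"
      unfolding hausdorff_outer_measure_def using d by (intro SUP_upper) auto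
    finally show "hausdorff_premeasure k \<delta> A + hausdorff_premeasure k \<delta> B \<le> hausdorff_outer_measure k (A \<union> B)" .
  qed
  finally show ?thesis .
qed

lemma hausdorff_outer_measure_separated_sum:
  assumes sep: "\<And>i j x y. i < j \<Longrightarrow> x \<in> R i \<Longrightarrow> y \<in> R j \<Longrightarrow> e j \<le> dist x y"
    and e: "\<And>j. 0 < e j"
  shows "(\<Sum>i<(N::nat). hausdorff_outer_measure k (R i)) \<le> hausdorff_outer_measure k (\<Union>i<N. R i)"
proof (induction N)
  case (Suc N)
  have "(\<Sum>i<Suc N. hausdorff_outer_measure k (R i))
      \<le> hausdorff_outer_measure k (\<Union>i<N. R i) + hausdorff_outer_measure k (R N)"
    using Suc by (simp add: add_right_mono)
  also have "\<dots> \<le> hausdorff_outer_measure k ((\<Union>i<N. R i) \<union> R N)"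
    by (rule hausdorff_outer_measure_separated[OF _ e[of N]]) (auto intro: sep)
  also have "(\<Union>i<N. R i) \<union> R N = (\<Union>i<Suc N. R i)"
    by (auto simp: less_Suc_eq)
  finally show ?case .
qed simp

lemma hausdorff_outer_measure_closed_split:
  fixes C :: "'a::metric_space set"
  assumes C: "closed C"
  shows "hausdorff_outer_measure k (X \<inter> C) + hausdorff_outer_measure k (X - C) \<le> hausdorff_outer_measure k X"
proof (cases "C = {} \<or> hausdorff_outer_measure k X = top")
  case True
  then show ?thesis by auto
next
  case False
  then have ne: "C \<noteq> {}" and fin: "hausdorff_outer_measure k X < top"
    by (auto simp: less_top)
  let ?f = "hausdorff_outer_measure k :: 'a set \<Rightarrow> ennreal"
  define A where "A n = {x \<in> X. 1 / real (Suc n) \<le> infdist x C}" for n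
  define R where "R n = {x \<in> X. 1 / real (Suc (Suc n)) \<le> infdist x C \<and> infdist x C < 1 / real (Suc n)}" for n
  have lip: "infdist x C \<le> infdist y C + dist x y" for x y :: 'a
    by (rule infdist_triangle)
  have XC: "X - C = A n \<union> (\<Union>i. R (i + n))" for n
  proof
    show "A n \<union> (\<Union>i. R (i + n)) \<subseteq> X - C"
    proof
      fix x assume x: "x \<in> A n \<union> (\<Union>i. R (i + n))"
      obtain m where "1 / real (Suc m) \<le> infdist x C"
        using x by (auto simp: A_def R_def simp del: of_nat_Suc)
      moreover have "0 < 1 / real (Suc m)"
        by simp
      ultimately have "0 < infdist x C"
        by linarith
      moreover have "x \<in> X"
        using x by (auto simp: A_def R_def)
      ultimately show "x \<in> X - C"
        by auto
    qed
    show "X - C \<subseteq> A n \<union> (\<Union>i. R (i + n))"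
    proof
      fix x assume x: "x \<in> X - C"
      then have pos: "0 < infdist x C"
        using infdist_pos_not_in_closed[OF C ne] by auto
      define m where "m = (LEAST m. 1 / real (Suc m) \<le> infdist x C)"
      have ex: "\<exists>m. 1 / real (Suc m) \<le> infdist x C"
        using pos nat_approx_posE less_imp_le by metis
      have m: "1 / real (Suc m) \<le> infdist x C"
        unfolding m_def by (rule LeastI_ex[OF ex])
      show "x \<in> A n \<union> (\<Union>i. R (i + n))"
      proof (cases "m \<le> n")
        case True
        then have "1 / real (Suc n) \<le> 1 / real (Suc m)"
          by (intro divide_left_mono) auto
        with m x show ?thesis
          by (auto simp: A_def)
      next
        case False
        then obtain i where i: "m = Suc (i + n)"
          by (metis add.commute less_imp_Suc_add not_le)
        have "\<not> 1 / real (Suc (i + n)) \<le> infdist x C"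
          using not_less_Least[of "i + n" "\<lambda>m. 1 / real (Suc m) \<le> infdist x C"] i
          unfolding m_def by auto
        then have "x \<in> R (i + n)"
          using m x i by (auto simp: R_def simp del: of_nat_Suc)
        then show ?thesis
          by blast
      qed
    qed
  qed
  have gap: "1 / real (Suc (Suc i)) - 1 / real (Suc j) \<le> dist x y" if "x \<in> R i" "y \<in> R j" for i j x y
    using that lip[of x y] by (auto simp: R_def)
  have half: "(\<Sum>i<N. ?f (R (2 * i + c))) \<le> ?f X" for N c
  proof -
    have "(\<Sum>i<N. ?f (R (2 * i + c))) \<le> ?f (\<Union>i<N. R (2 * i + c))"
    proof (rule hausdorff_outer_measure_separated_sum)
      fix i j :: nat and x y
      assume ij: "i < j" and x: "x \<in> R (2 * i + c)" and y: "y \<in> R (2 * j + c)"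
      have "1 / real (2 * j + c) \<le> 1 / real (Suc (Suc (2 * i + c)))"
        using ij by (intro divide_left_mono) auto
      moreover have "1 / real (2 * j + c) - 1 / real (Suc (2 * j + c)) > 0"
        if "0 < j"
        using that by (auto intro!: divide_strict_left_mono)
      ultimately show "(if j = 0 then 1 else 1 / real (2 * j + c) - 1 / real (Suc (2 * j + c))) \<le> dist x y"
        using gap[OF x y] ij by auto
    next
      show "0 < (if j = 0 then 1 else 1 / real (2 * j + c) - 1 / real (Suc (2 * j + c)))" for j
        by (auto intro!: divide_strict_left_mono)
    qed
    also have "\<dots> \<le> ?f X"
      by (intro hausdorff_outer_measure_mono) (auto simp: R_def)
    finally show ?thesis .
  qed
  have bound: "(\<Sum>i<N. ?f (R i)) \<le> ?f X + ?f X" for N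
  proof -
    have "(\<Sum>i<N. ?f (R i)) \<le> (\<Sum>i<2 * N. ?f (R i))"
      by (intro sum_mono2) auto
    also have "\<dots> = (\<Sum>i<N. ?f (R (2 * i + 0))) + (\<Sum>i<N. ?f (R (2 * i + 1)))"
      by (induction N) (auto simp: ac_simps)
    also have "\<dots> \<le> ?f X + ?f X"
      by (intro add_mono half)
    finally show ?thesis .
  qed
  have "(\<Sum>i. ?f (R i)) \<le> ?f X + ?f X"
    by (intro suminf_le_const bound) auto
  then have sumfin: "(\<Sum>i. ?f (R i)) < top"
    using fin by (auto simp: less_top[symmetric] top_unique)
  have A_bound: "?f (X \<inter> C) + ?f (A n) \<le> ?f X" for n
  proof -
    have "?f (X \<inter> C) + ?f (A n) \<le> ?f ((X \<inter> C) \<union> A n)"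
    proof (rule hausdorff_outer_measure_separated)
      fix x y assume "x \<in> X \<inter> C" "y \<in> A n"
      then show "1 / real (Suc n) \<le> dist x y"
        using lip[of y x] by (auto simp: A_def dist_commute)
    qed simp
    also have "\<dots> \<le> ?f X"
      by (intro hausdorff_outer_measure_mono) (auto simp: A_def)
    finally show ?thesis .
  qed
  show ?thesis
  proof (rule ennreal_le_epsilon)
    fix e :: real assume e: "0 < e"
    have "\<exists>n. (\<Sum>i. ?f (R (i + n))) \<le> ennreal e"
    proof -
      have r: "?f (R i) = ennreal (enn2real (?f (R i)))" for i
        using ennreal_suminf_lessD[OF sumfin, of i] by simp
      have sm: "summable (\<lambda>i. enn2real (?f (R i)))"
        using sumfin by (intro summable_suminf_not_top) (auto simp flip: r)
      obtain n where n: "\<bar>\<Sum>i. enn2real (?f (R (i + n)))\<bar> < e"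
        using suminf_exist_split[OF e sm] by auto
      have "(\<Sum>i. ?f (R (i + n))) = (\<Sum>i. ennreal (enn2real (?f (R (i + n)))))"
        by (subst r) simp
      also have "\<dots> = ennreal (\<Sum>i. enn2real (?f (R (i + n))))"
        by (rule suminf_ennreal2) (use sm in \<open>auto intro: summable_ignore_initial_segment\<close>)
      also have "\<dots> \<le> ennreal e"
        using n by (intro ennreal_leI) auto
      finally show ?thesis ..
    qed
    then obtain n where n: "(\<Sum>i. ?f (R (i + n))) \<le> ennreal e" ..
    have "?f (X - C) \<le> ?f (A n) + ?f (\<Union>i. R (i + n))"
      by (subst XC[of n]) (rule hausdorff_outer_measure_subadditive)
    also have "\<dots> \<le> ?f (A n) + ennreal e"
      using n by (intro add_left_mono order_trans[OF hausdorff_outer_measure_countable_subadditive])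
    finally have "?f (X \<inter> C) + ?f (X - C) \<le> (?f (X \<inter> C) + ?f (A n)) + ennreal e"
      by (simp add: add.assoc add_left_mono)
    also have "\<dots> \<le> ?f X + ennreal e"
      by (intro add_right_mono A_bound)
    finally show "?f (X \<inter> C) + ?f (X - C) \<le> ?f X + ennreal e" .
  qed
qed

lemma sets_hausdorff_measure [simp, measurable_cong]: "sets (hausdorff_measure k) = sets borel"
  unfolding hausdorff_measure_def
  by (metis sets.sigma_sets_eq sets_measure_of space_borel subset_UNIV Pow_UNIV)

lemma space_hausdorff_measure [simp]: "space (hausdorff_measure k) = UNIV"
  by (simp add: hausdorff_measure_def space_measure_of_conv)

theorem emeasure_hausdorff_measure:
  fixes A :: "'a::metric_space set"
  assumes "A \<in> sets borel"
  shows "emeasure (hausdorff_measure k) A = hausdorff_outer_measure k A"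
proof -
  let ?f = "hausdorff_outer_measure k :: 'a set \<Rightarrow> ennreal"
  let ?L = "lambda_system UNIV UNIV ?f"
  interpret P: sigma_algebra "UNIV :: 'a set" UNIV
    using sigma_algebra_Pow[of "UNIV :: 'a set"] by simp
  have ms: "measure_space UNIV ?L ?f"
    by (rule P.caratheodory_lemma[OF outer_measure_space_hausdorff])
  interpret L: sigma_algebra "UNIV :: 'a set" ?L
    using ms by (simp add: measure_space_def)
  have cl: "C \<in> ?L" if "closed C" for C
  proof -
    have "?f (x \<inter> C) + ?f (x - C) = ?f x" for x
    proof (rule antisym)
      show "?f (x \<inter> C) + ?f (x - C) \<le> ?f x"
        using that by (rule hausdorff_outer_measure_closed_split)
      show "?f x \<le> ?f (x \<inter> C) + ?f (x - C)"
        using hausdorff_outer_measure_subadditive[of k "x \<inter> C" "x - C"] by (simp add: Int_Diff_Un)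
    qed
    then show ?thesis
      by (simp add: P.lambda_system_eq)
  qed
  have sub: "sets borel \<subseteq> ?L"
    unfolding borel_eq_closed using cl L.sigma_sets_subset[of "Collect closed"] by auto
  have "countably_additive ?L ?f" "positive ?L ?f"
    using ms by (auto simp: measure_space_def)
  then have "countably_additive (sets borel) ?f" "positive (sets borel) ?f"
    using sub by (auto simp: countably_additive_def positive_def subset_iff image_subset_iff)
  then show ?thesis
    using assms unfolding hausdorff_measure_def
    by (intro emeasure_measure_of_sigma)
       (auto simp: sets.sigma_algebra_axioms[of borel, simplified])
qed


section \<open>The density \<open>r\<^sup>p\<close>\<close>

text \<open>
  For \<open>p < 0\<close> the density is infinite at the origin, where \<open>0 powr p = 0\<close>. In dimension at least 2
  this is immaterial, since a point is null for volume and for hypersurface area.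
\<close>

definition weighted_volume :: "real \<Rightarrow> 'a::euclidean_space set \<Rightarrow> ennreal" where
  "weighted_volume p E = (\<integral>\<^sup>+ x\<in>E. ennreal (norm x powr p) \<partial>lebesgue)"

definition weighted_perimeter :: "real \<Rightarrow> 'a::euclidean_space set \<Rightarrow> ennreal" where
  "weighted_perimeter p E =
     (\<integral>\<^sup>+ x\<in>frontier E. ennreal (norm x powr p) \<partial>hausdorff_measure (DIM('a) - 1))"

text \<open>
  Regions are Lebesgue measurable sets, bounded or not and of finite or infinite perimeter.
  The weighted volume prescribed by the isoperimetric problem is a positive real number; for
  volume \<open>0\<close> or \<open>\<infinity>\<close> the empty set and the whole space would be trivial minimisers.
\<close>

definition isoperimetric_region :: "real \<Rightarrow> 'a::euclidean_space set \<Rightarrow> bool" where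
  "isoperimetric_region p E \<longleftrightarrow>
     E \<in> sets lebesgue \<and> 0 < weighted_volume p E \<and> weighted_volume p E < \<infinity> \<and>
     (\<forall>F \<in> sets (lebesgue :: 'a measure). weighted_volume p F = weighted_volume p E \<longrightarrow>
        weighted_perimeter p E \<le> weighted_perimeter p F)"

end

theory Submission
  imports Defs
begin

text \<open>
  Write \<open>n\<close> for the dimension. A negative power of \<open>r\<close> makes boundary cheap far away from the origin,
  while for \<open>p \<ge> -n\<close> there is still infinite volume out there, so a prescribed volume can be moved
  to infinity. If \<open>p > -n\<close>, a ball at distance \<open>2 a\<close> from the origin with weighted volume \<open>V\<close> has a
  radius \<open>t\<close> with \<open>t\<^sup>n\<close> of order \<open>V a powr -p\<close>, and its perimeter is of order \<open>V / t\<close>, which tends to \<open>0\<close> as \<open>a\<close>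
  grows (\<open>exists_small_perimeter_supercritical\<close>). In the scale invariant case \<open>p = -n\<close> a centred
  annulus of volume \<open>V\<close> and inner radius \<open>a\<close> has perimeter of order \<open>1 / a\<close>
  (\<open>exists_small_perimeter_critical\<close>). The volume \<open>V\<close> is attained exactly by continuity in the radius
  (\<open>exists_ball_diff_weighted_volume\<close>), and the perimeter bounds rest on
  the fact that a sphere of radius \<open>s\<close> has area at most a constant times \<open>s\<^sup>n\<^sup>-\<^sup>1\<close> (\<open>hausdorff_outer_measure_sphere_le\<close>).

  An isoperimetric region would then have weighted perimeter \<open>0\<close>, so its topological frontier would
  have zero area. The area-null frontier does not separate space, so the region or its complement
  is Lebesgue null (\<open>frontier_null_imp_negligible_or_conegligible\<close>). Its weighted volume is therefore \<open>0\<close>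
  or that of the whole space, which is infinite for \<open>p \<ge> -n\<close>; neither is a positive real number.
\<close>

section \<open>Hausdorff measure of spheres\<close>

lemma power_diff_le:
  fixes x y :: real
  assumes "0 \<le> y" "y \<le> x"
  shows "x ^ Suc k - y ^ Suc k \<le> real (Suc k) * x ^ k * (x - y)"
proof (induction k)
  case (Suc k)
  have "x ^ Suc (Suc k) - y ^ Suc (Suc k) = x * (x ^ Suc k - y ^ Suc k) + y ^ Suc k * (x - y)"
    by (simp add: algebra_simps)
  also have "\<dots> \<le> x * (real (Suc k) * x ^ k * (x - y)) + x ^ Suc k * (x - y)"
    using assms by (intro add_mono mult_left_mono Suc mult_right_mono power_mono) auto
  also have "\<dots> = real (Suc (Suc k)) * x ^ Suc k * (x - y)"
    by (simp add: algebra_simps)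
  finally show ?case .
qed simp

text \<open>
  A packing bound: balls of radius \<open>\<delta>/2\<close> around separated points are disjoint and lie in a spherical
  shell of thickness \<open>\<delta>\<close>, whose volume is of order \<open>s\<^sup>n\<^sup>-\<^sup>1 \<delta>\<close>.
\<close>

lemma card_separated_sphere_le:
  fixes c :: "'a::euclidean_space"
  assumes F: "finite F" "F \<subseteq> sphere c s"
    and sep: "\<And>x y. x \<in> F \<Longrightarrow> y \<in> F \<Longrightarrow> x \<noteq> y \<Longrightarrow> \<delta> \<le> dist x y"
    and \<delta>: "0 < \<delta>" "\<delta> \<le> s"
  shows "real (card F) * \<delta> ^ (DIM('a) - 1) \<le> real DIM('a) * 4 ^ DIM('a) * s ^ (DIM('a) - 1)"
proof -
  define k where "k = DIM('a) - 1"
  have n: "DIM('a) = Suc k"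
    by (simp add: k_def)
  let ?\<omega> = "unit_ball_vol (real DIM('a))"
  let ?shell = "ball c (s + \<delta>/2) - cball c (s - \<delta>/2)"
  have "real (card F) * (?\<omega> * (\<delta>/2) ^ Suc k) = (\<Sum>x\<in>F. measure lebesgue (ball x (\<delta>/2)))"
    using \<delta> by (simp add: content_ball n)
  also have "\<dots> = measure lebesgue (\<Union>x\<in>F. ball x (\<delta>/2))"
  proof (rule measure_UNION'[symmetric, simplified])
    have "ball x (\<delta>/2) \<inter> ball y (\<delta>/2) = {}" if "x \<in> F" "y \<in> F" "x \<noteq> y" for x y
      using sep[OF that] by (simp add: disjoint_ballI)
    then show "pairwise (\<lambda>i j. disjnt (ball i (\<delta>/2)) (ball j (\<delta>/2))) F"
      by (auto simp: pairwise_def disjnt_def)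
  qed (use F in auto)
  also have "\<dots> \<le> measure lebesgue ?shell"
  proof (rule measure_mono_fmeasurable)
    have "y \<in> ?shell" if "x \<in> F" "y \<in> ball x (\<delta>/2)" for x y
    proof -
      have "dist c x = s" "dist x y < \<delta>/2"
        using that F by auto
      then show ?thesis
        using dist_triangle[of c y x] dist_triangle[of c x y] by (auto simp: dist_commute)
    qed
    then show "(\<Union>x\<in>F. ball x (\<delta>/2)) \<subseteq> ?shell"
      by blast
  qed (use F in auto)
  also have "\<dots> = measure lebesgue (ball c (s + \<delta>/2)) - measure lebesgue (cball c (s - \<delta>/2))"
    using \<delta> by (subst measurable_measure_Diff) (auto simp: subset_eq)
  also have "\<dots> = ?\<omega> * ((s + \<delta>/2) ^ Suc k - (s - \<delta>/2) ^ Suc k)"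
    using \<delta> by (simp add: content_ball content_cball n right_diff_distrib)
  also have "\<dots> \<le> ?\<omega> * (real (Suc k) * (s + \<delta>/2) ^ k * ((s + \<delta>/2) - (s - \<delta>/2)))"
    using \<delta> by (intro mult_left_mono power_diff_le) auto
  also have "\<dots> \<le> ?\<omega> * (real (Suc k) * (2 * s) ^ k * \<delta>)"
    using \<delta> by (intro mult_left_mono mult_mono power_mono) auto
  finally have "?\<omega> * (real (card F) * (\<delta>/2) ^ Suc k) \<le> ?\<omega> * (real (Suc k) * (2 * s) ^ k * \<delta>)"
    by (simp only: mult.left_commute)
  then have "real (card F) * (\<delta>/2) ^ Suc k \<le> real (Suc k) * (2 * s) ^ k * \<delta>"
    using unit_ball_vol_pos[of "real DIM('a)"] by (subst (asm) mult_le_cancel_left_pos) auto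
  then have "2 ^ Suc k * (real (card F) * (\<delta>/2) ^ Suc k) \<le> 2 ^ Suc k * (real (Suc k) * (2 * s) ^ k * \<delta>)"
    by (intro mult_left_mono) auto
  also have "2 ^ Suc k * (real (card F) * (\<delta>/2) ^ Suc k) = real (card F) * \<delta> ^ k * \<delta>"
    by (simp add: power_divide)
  finally have "real (card F) * \<delta> ^ k * \<delta> \<le> (2 ^ Suc k * (real (Suc k) * (2 * s) ^ k)) * \<delta>"
    by (simp only: mult.assoc)
  then have "real (card F) * \<delta> ^ k \<le> 2 ^ Suc k * (real (Suc k) * (2 * s) ^ k)"
    using \<delta> by (simp only: mult_le_cancel_right_pos)
  also have "\<dots> = real (Suc k) * (2 ^ Suc k * 2 ^ k) * s ^ k"
    by (simp add: power_mult_distrib mult_ac)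
  also have "\<dots> \<le> real (Suc k) * 4 ^ Suc k * s ^ k"
  proof -
    have "(2::real) ^ Suc k * 2 ^ k \<le> 2 ^ Suc k * 2 ^ Suc k"
      by (intro mult_left_mono power_increasing) auto
    also have "\<dots> = 4 ^ Suc k"
      by (simp only: power_mult_distrib[symmetric]) simp
    finally show ?thesis
      using \<delta> by (intro mult_right_mono mult_left_mono) auto
  qed
  finally show ?thesis
    by (simp add: n)
qed

text \<open>
  A maximal \<open>\<delta>\<close>-separated subset of the sphere is a \<open>\<delta>\<close>-net, so the packing bound controls the gauge
  sum of a cover by balls of radius \<open>\<delta>\<close>, uniformly in \<open>\<delta>\<close>.
\<close>

lemma hausdorff_outer_measure_sphere_le:
  fixes c :: "'a::euclidean_space"
  assumes s: "0 < s"
  shows "hausdorff_outer_measure (DIM('a) - 1) (sphere c s)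
    \<le> ennreal (unit_ball_vol (real (DIM('a) - 1)) * real DIM('a) * 4 ^ DIM('a) * s ^ (DIM('a) - 1))"
  unfolding hausdorff_outer_measure_def
proof (rule SUP_least)
  fix \<delta>' :: real assume "\<delta>' \<in> {0<..}"
  define \<delta> where "\<delta> = min (\<delta>'/2) s"
  have \<delta>: "0 < \<delta>" "\<delta> \<le> s" "2 * \<delta> \<le> \<delta>'"
    using s \<open>\<delta>' \<in> {0<..}\<close> by (auto simp: \<delta>_def)
  define k where "k = DIM('a) - 1"
  let ?B = "real DIM('a) * 4 ^ DIM('a) * s ^ k"
  define sepd where "sepd F \<longleftrightarrow> finite F \<and> F \<subseteq> sphere c s \<and>
      (\<forall>x\<in>F. \<forall>y\<in>F. x \<noteq> y \<longrightarrow> \<delta> \<le> dist x y)" for F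
  have card_le: "real (card F) * \<delta> ^ k \<le> ?B" if "sepd F" for F
    using card_separated_sphere_le[of F c s \<delta>] that \<delta> by (auto simp: sepd_def k_def)
  have "\<exists>F. sepd F \<and> (\<forall>G. sepd G \<longrightarrow> card G \<le> card F)"
  proof (rule Lattices_Big.ex_has_greatest_nat)
    show "sepd {}"
      by (simp add: sepd_def)
    have "card G < nat \<lceil>?B / \<delta> ^ k\<rceil> + 1" if "sepd G" for G
    proof -
      have "real (card G) \<le> ?B / \<delta> ^ k"
        using card_le[OF that] \<delta> by (simp add: pos_le_divide_eq)
      then show ?thesis
        by linarith
    qed
    then show "\<forall>G. sepd G \<longrightarrow> card G < nat \<lceil>?B / \<delta> ^ k\<rceil> + 1"
      by blast
  qed
  then obtain F where F: "sepd F" and max: "\<And>G. sepd G \<Longrightarrow> card G \<le> card F"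
    by blast
  have cover: "\<exists>x\<in>F. dist x y < \<delta>" if y: "y \<in> sphere c s" for y
  proof (rule ccontr)
    assume far: "\<not> ?thesis"
    then have "y \<notin> F" "sepd (insert y F)"
      using F y \<delta> by (auto simp: sepd_def dist_commute not_less)
    then show False
      using max[of "insert y F"] F by (simp add: sepd_def)
  qed
  define N where "N = card F"
  obtain e where e: "bij_betw e {..<N} F"
    using ex_bij_betw_nat_finite[of F] F by (auto simp: sepd_def N_def atLeast0LessThan)
  define U where "U i = (if i < N then cball (e i) \<delta> else {})" for i
  have "hausdorff_cover \<delta>' (sphere c s) U"
    unfolding hausdorff_cover_def
  proof (intro conjI allI subsetI)
    fix y assume "y \<in> sphere c s"
    then obtain i where "i < N" "dist (e i) y < \<delta>"
      using cover[of y] e by (auto simp: bij_betw_def)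
    then show "y \<in> (\<Union>i. U i)"
      by (auto simp: U_def intro!: exI[of _ i])
  next
    fix i
    show "bounded (U i)" "diameter (U i) \<le> \<delta>'"
      using \<delta> by (auto simp: U_def)
  qed
  then have "hausdorff_premeasure k \<delta>' (sphere c s) \<le> (\<Sum>i. hausdorff_gauge k (U i))"
    unfolding hausdorff_premeasure_def by (intro INF_lower) auto
  also have "\<dots> = (\<Sum>i<N. hausdorff_gauge k (U i))"
    by (rule suminf_finite) (auto simp: U_def)
  also have "\<dots> = (\<Sum>i<N. ennreal (unit_ball_vol (real k) * \<delta> ^ k))"
    using \<delta> by (intro sum.cong) (auto simp: U_def hausdorff_gauge_def)
  also have "\<dots> = ennreal (unit_ball_vol (real k) * (real N * \<delta> ^ k))"
    using \<delta> by (simp add: ennreal_of_nat_eq_real_of_nat ennreal_mult[symmetric] mult_ac)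
  also have "\<dots> \<le> ennreal (unit_ball_vol (real k) * ?B)"
    using card_le[OF F] unfolding N_def by (intro ennreal_leI mult_left_mono) auto
  finally show "hausdorff_premeasure (DIM('a) - 1) \<delta>' (sphere c s)
    \<le> ennreal (unit_ball_vol (real (DIM('a) - 1)) * real DIM('a) * 4 ^ DIM('a) * s ^ (DIM('a) - 1))"
    by (simp add: k_def mult.assoc)
qed

section \<open>Sets with a frontier of zero area\<close>

text \<open>
  A set of diameter less than \<open>d\<close>, swept along a segment, stays inside about \<open>\<bar>w\<bar>/d\<close> balls of radius
  \<open>2 d\<close> centred along the segment. Their total volume is of order \<open>d\<^sup>n\<^sup>-\<^sup>1\<close>; letting \<open>d\<close> decrease to the
  diameter includes sets of diameter \<open>0\<close>. The closure makes the swept set compact, hence measurable.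
\<close>

lemma measure_sweep_le:
  fixes U :: "'a::euclidean_space set" and w :: 'a
  assumes U: "bounded U" "U \<noteq> {}" and diam: "diameter U < 1"
  defines "T \<equiv> (\<lambda>(x, t). x + t *\<^sub>R w) ` (closure U \<times> {0..1::real})"
  shows "measure lebesgue T \<le>
    unit_ball_vol (real DIM('a)) * 2 ^ DIM('a) * (norm w + 3) * diameter U ^ (DIM('a) - 1)"
    and "compact T"
proof -
  define k where "k = DIM('a) - 1"
  have n: "DIM('a) = Suc k"
    by (simp add: k_def)
  show "compact T"
    unfolding T_def using U
    by (intro compact_continuous_image compact_Times; (unfold case_prod_beta)?; (intro continuous_intros)?) auto
  let ?\<omega> = "unit_ball_vol (real DIM('a))"
  obtain u where u: "u \<in> U"
    using U by blast
  have bound: "measure lebesgue T \<le> ?\<omega> * 2 ^ DIM('a) * (norm w + 3) * d ^ k"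
    if d: "diameter U < d" "d < 1" for d
  proof -
    have d0: "0 < d"
      using diameter_ge_0[OF U(1)] d by linarith
    have "closure U \<subseteq> cball u d"
      using diameter_bounded_bound[OF U(1) u] d by (intro closure_minimal) force+
    then have near: "dist u x \<le> d" if "x \<in> closure U" for x
      using that by auto
    \<comment> \<open>Consecutive centres are at distance \<open>norm w / m \<le> d\<close>.\<close>
    define m where "m = nat \<lceil>norm w / d\<rceil> + 1"
    have m: "norm w \<le> d * real m" "real m \<le> norm w / d + 2" "0 < m"
    proof -
      have "norm w / d \<le> real m" "real m \<le> norm w / d + 2" "0 < m"
        using d0 unfolding m_def by (auto simp: of_nat_nat) linarith+
      then show "norm w \<le> d * real m" "real m \<le> norm w / d + 2" "0 < m"
        using d0 by (auto simp: pos_divide_le_eq mult.commute)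
    qed
    have "T \<subseteq> (\<Union>j\<in>{..m}. cball (u + (real j / real m) *\<^sub>R w) (2 * d))"
    proof
      fix y assume "y \<in> T"
      then obtain x t where y: "y = x + t *\<^sub>R w" "x \<in> closure U" "0 \<le> t" "t \<le> 1"
        by (auto simp: T_def)
      define j where "j = nat \<lfloor>t * real m\<rfloor>"
      have j: "real j \<le> t * real m" "t * real m < real j + 1"
        using y unfolding j_def by (auto simp: of_nat_nat)
      have "real j \<le> real m"
        using j(1) y(4) mult_right_mono[of t 1 "real m"] by auto
      have "real j / real m \<le> t" "t < real j / real m + 1 / real m"
        using j m(3) by (simp_all add: field_simps)
      then have "\<bar>real j / real m - t\<bar> \<le> 1 / real m"
        by linarith
      then have "\<bar>real j / real m - t\<bar> * norm w \<le> (1 / real m) * (d * real m)"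
        using m(1) by (intro mult_mono) auto
      also have "\<dots> = d"
        using m(3) by simp
      finally have "\<bar>real j / real m - t\<bar> * norm w \<le> d" .
      moreover have "dist (u + (real j / real m) *\<^sub>R w) y \<le> dist u x + norm ((real j / real m - t) *\<^sub>R w)"
        unfolding dist_norm y(1)
        by (rule order_trans[OF _ norm_triangle_ineq]) (simp add: algebra_simps)
      ultimately have "dist (u + (real j / real m) *\<^sub>R w) y \<le> 2 * d"
        using near[OF y(2)] by simp
      then show "y \<in> (\<Union>j\<in>{..m}. cball (u + (real j / real m) *\<^sub>R w) (2 * d))"
        using \<open>real j \<le> real m\<close> by auto
    qed
    then have "measure lebesgue T \<le> measure lebesgue (\<Union>j\<in>{..m}. cball (u + (real j / real m) *\<^sub>R w) (2 * d))"
      using \<open>compact T\<close> by (intro measure_mono_fmeasurable) (auto intro: fmeasurableD lmeasurable_compact)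
    also have "\<dots> \<le> (\<Sum>j\<in>{..m}. measure lebesgue (cball (u + (real j / real m) *\<^sub>R w) (2 * d)))"
      by (intro measure_UNION_le) auto
    also have "\<dots> = (real m + 1) * (?\<omega> * (2 * d) ^ Suc k)"
      using d0 by (simp add: content_cball n)
    also have "\<dots> \<le> (norm w / d + 3) * (?\<omega> * (2 * d) ^ Suc k)"
      using m d0 by (intro mult_right_mono) auto
    also have "\<dots> = ?\<omega> * 2 ^ Suc k * (norm w + 3 * d) * d ^ k"
      using d0 by (simp add: power_mult_distrib field_simps)
    also have "\<dots> \<le> ?\<omega> * 2 ^ Suc k * (norm w + 3) * d ^ k"
      using d d0 by (intro mult_right_mono mult_left_mono) auto
    finally show ?thesis
      by (simp add: n)
  qed
  have "measure lebesgue T \<le> ?\<omega> * 2 ^ DIM('a) * (norm w + 3) * diameter U ^ k"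
  proof (rule tendsto_lowerbound)
    show "((\<lambda>d. ?\<omega> * 2 ^ DIM('a) * (norm w + 3) * d ^ k) \<longlongrightarrow>
        ?\<omega> * 2 ^ DIM('a) * (norm w + 3) * diameter U ^ k) (at_right (diameter U))"
      by (intro tendsto_intros)
    show "\<forall>\<^sub>F d in at_right (diameter U).
        measure lebesgue T \<le> ?\<omega> * 2 ^ DIM('a) * (norm w + 3) * d ^ k"
      using eventually_at_right_less[of "diameter U"] eventually_at_right_real[OF diam]
      by eventually_elim (use bound in auto)
  qed simp
  then show "measure lebesgue T \<le> ?\<omega> * 2 ^ DIM('a) * (norm w + 3) * diameter U ^ (DIM('a) - 1)"
    by (simp add: k_def)
qed

text \<open>
  Sweeping along a segment raises the dimension by at most one: the volume of the swept cover is at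
  most a constant times the \<open>(n - 1)\<close>-dimensional gauge sum of the cover, which can be made arbitrarily
  small.
\<close>

lemma negligible_sweep:
  fixes K :: "'a::euclidean_space set" and w :: 'a
  assumes K: "hausdorff_outer_measure (DIM('a) - 1) K = 0"
  shows "negligible {x + t *\<^sub>R w | x t. x \<in> K \<and> t \<in> {0..1}}" (is "negligible ?S")
  unfolding negligible_outer_le
proof (intro allI impI)
  fix e :: real assume e: "0 < e"
  define k where "k = DIM('a) - 1"
  \<comment> \<open>\<open>B\<close> is the constant of the sweep estimate; \<open>\<eta>\<close> is the gauge sum for which the swept cover has volume \<open>e\<close>.\<close>
  define B where "B = unit_ball_vol (real DIM('a)) * 2 ^ DIM('a) * (norm w + 3)"
  define \<eta> where "\<eta> = e * unit_ball_vol (real k) / (B * 2 ^ k)"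
  have pos: "0 < B" "0 < unit_ball_vol (real k)"
    by (auto simp: B_def intro!: mult_pos_pos add_nonneg_pos)
  have ne: "unit_ball_vol (real k) \<noteq> 0"
    using pos(2) by (rule less_imp_neq[THEN not_sym])
  have \<eta>: "0 < \<eta>"
    using e pos by (simp add: \<eta>_def)
  have "hausdorff_premeasure k (1/2) K \<le> hausdorff_outer_measure k K"
    unfolding hausdorff_outer_measure_def by (rule SUP_upper) simp
  also have "\<dots> < ennreal \<eta>"
    using K \<eta> by (simp add: k_def)
  finally have "(INF U\<in>{U. hausdorff_cover (1/2) K U}. \<Sum>i. hausdorff_gauge k (U i)) < ennreal \<eta>"
    by (simp add: hausdorff_premeasure_def)
  then obtain U where U: "hausdorff_cover (1/2) K U" and sum: "(\<Sum>i. hausdorff_gauge k (U i)) < ennreal \<eta>"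
    by (auto simp: INF_less_iff)
  define T where "T i = (\<lambda>(x, t). x + t *\<^sub>R w) ` (closure (U i) \<times> {0..1::real})" for i
  have T: "compact (T i)"
    "emeasure lebesgue (T i) \<le> ennreal (B * 2 ^ k / unit_ball_vol (real k)) * hausdorff_gauge k (U i)" for i
  proof -
    have Ui: "bounded (U i)" "diameter (U i) < 1"
      using U by (auto simp: hausdorff_cover_def intro: le_less_trans[of _ "1/2"])
    have "compact (T i) \<and> emeasure lebesgue (T i)
      \<le> ennreal (B * 2 ^ k / unit_ball_vol (real k)) * hausdorff_gauge k (U i)"
    proof (cases "U i = {}")
      case False
      have c: "compact (T i)"
        using measure_sweep_le(2)[OF Ui(1) False Ui(2)] by (simp add: T_def)
      have "measure lebesgue (T i) \<le> B * diameter (U i) ^ k"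
        using measure_sweep_le(1)[OF Ui(1) False Ui(2), of w] by (simp add: T_def B_def k_def)
      also have "\<dots> = (B * 2 ^ k / unit_ball_vol (real k)) * (unit_ball_vol (real k) * (diameter (U i) / 2) ^ k)"
        by (simp only: times_divide_eq_left mult.assoc power_divide) (use ne in \<open>simp add: field_simps\<close>)
      finally have "ennreal (measure lebesgue (T i)) \<le>
          ennreal (B * 2 ^ k / unit_ball_vol (real k)) * hausdorff_gauge k (U i)"
        using False pos ne diameter_ge_0[OF Ui(1)]
        by (simp add: hausdorff_gauge_def ennreal_leI flip: ennreal_mult)
      moreover have "emeasure lebesgue (T i) = ennreal (measure lebesgue (T i))"
        using lmeasurable_compact[OF c] by (intro emeasure_eq_measure2) (auto simp: fmeasurable_def)
      ultimately show ?thesis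
        using c by simp
    qed (simp add: T_def)
    then show "compact (T i)"
      "emeasure lebesgue (T i) \<le> ennreal (B * 2 ^ k / unit_ball_vol (real k)) * hausdorff_gauge k (U i)"
      by auto
  qed
  have meas: "T i \<in> sets lebesgue" for i
    using lmeasurable_compact[OF T(1)[of i]] by (rule fmeasurableD)
  have "emeasure lebesgue (\<Union>i. T i) \<le> (\<Sum>i. emeasure lebesgue (T i))"
    using meas by (intro emeasure_subadditive_countably) auto
  also have "\<dots> \<le> (\<Sum>i. ennreal (B * 2 ^ k / unit_ball_vol (real k)) * hausdorff_gauge k (U i))"
    by (intro suminf_le T) auto
  also have "\<dots> = ennreal (B * 2 ^ k / unit_ball_vol (real k)) * (\<Sum>i. hausdorff_gauge k (U i))"
    by (rule ennreal_suminf_cmult)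
  also have "\<dots> \<le> ennreal (B * 2 ^ k / unit_ball_vol (real k)) * ennreal \<eta>"
    using sum by (intro mult_left_mono) auto
  also have "\<dots> = ennreal e"
    using pos(1) ne \<eta> by (simp add: \<eta>_def flip: ennreal_mult)
  finally have le: "emeasure lebesgue (\<Union>i. T i) \<le> ennreal e" .
  moreover have UT: "(\<Union>i. T i) \<in> lmeasurable"
    using le meas by (intro fmeasurableI) (auto intro: le_less_trans)
  ultimately have "measure lebesgue (\<Union>i. T i) \<le> e"
    using e by (simp add: emeasure_eq_measure2 fmeasurableD2)
  moreover have "?S \<subseteq> (\<Union>i. T i)"
  proof
    fix y assume "y \<in> ?S"
    then obtain x t where y: "y = x + t *\<^sub>R w" "x \<in> K" "t \<in> {0..1}"
      by auto
    then obtain i where "x \<in> U i"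
      using U by (auto simp: hausdorff_cover_def)
    then have "y \<in> T i"
      using y closure_subset[of "U i"] unfolding T_def by (intro image_eqI[of _ _ "(x, t)"]) auto
    then show "y \<in> (\<Union>i. T i)"
      by blast
  qed
  ultimately show "\<exists>T. ?S \<subseteq> T \<and> T \<in> lmeasurable \<and> measure lebesgue T \<le> e"
    using UT by blast
qed

lemma hausdorff_null_imp_negligible:
  fixes K :: "'a::euclidean_space set"
  assumes "hausdorff_outer_measure (DIM('a) - 1) K = 0"
  shows "negligible K"
  by (rule negligible_subset[OF negligible_sweep[OF assms, of 0]]) (auto intro: exI[of _ 0])

text \<open>
  A frontier of zero area does not separate. If \<open>E\<close> and its complement both contained a ball, of the
  same radius, then every segment from a point of the first ball to the corresponding point of the
  second would cross the frontier, so the first ball would be covered by the frontier swept along the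
  reversed translation vector, a null set. Hence one of the two has empty interior and lies in the
  frontier.
\<close>

lemma frontier_null_imp_negligible_or_conegligible:
  fixes E :: "'a::euclidean_space set"
  assumes null: "hausdorff_outer_measure (DIM('a) - 1) (frontier E) = 0"
  shows "negligible E \<or> negligible (- E)"
proof (rule ccontr)
  assume neg: "\<not> ?thesis"
  have fr: "negligible (frontier E)"
    using null by (rule hausdorff_null_imp_negligible)
  have ex: "interior S \<noteq> {}" if "\<not> negligible S" "frontier S = frontier E" for S :: "'a set"
  proof
    assume "interior S = {}"
    then have "S \<subseteq> frontier E"
      using that(2) closure_subset[of S] by (auto simp: frontier_def)
    then show False
      using fr that(1) negligible_subset by blast
  qed
  obtain a b where a: "a \<in> interior E" and b: "b \<in> interior (- E)"
    using ex[of E] ex[of "- E"] neg by auto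
  obtain r1 r2 where r: "0 < r1" "ball a r1 \<subseteq> E" "0 < r2" "ball b r2 \<subseteq> - E"
    using a b unfolding mem_interior by blast
  define r where "r = min r1 r2"
  have "0 < r"
    using r(1,3) by (simp add: r_def)
  have "ball a r \<subseteq> {x + t *\<^sub>R (a - b) | x t. x \<in> frontier E \<and> t \<in> {0..1}}"
  proof
    fix y assume y: "y \<in> ball a r"
    have "y \<in> E"
      using y r by (auto simp: r_def)
    moreover have "y + (b - a) \<in> - E"
    proof -
      have "dist b (y + (b - a)) = dist a y"
        by (simp add: dist_norm algebra_simps)
      then have "y + (b - a) \<in> ball b r2"
        using y by (simp add: r_def)
      then show ?thesis
        using r by blast
    qed
    ultimately have "closed_segment y (y + (b - a)) \<inter> frontier E \<noteq> {}"
      by (intro connected_Int_frontier) auto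
    then obtain t where t: "0 \<le> t" "t \<le> 1" "(1 - t) *\<^sub>R y + t *\<^sub>R (y + (b - a)) \<in> frontier E"
      by (auto simp: closed_segment_def)
    moreover have "y = ((1 - t) *\<^sub>R y + t *\<^sub>R (y + (b - a))) + t *\<^sub>R (a - b)"
      by (simp add: algebra_simps)
    ultimately show "y \<in> {x + t *\<^sub>R (a - b) | x t. x \<in> frontier E \<and> t \<in> {0..1}}"
      by auto
  qed
  then have "negligible (ball a r)"
    using negligible_sweep[OF null] negligible_subset by blast
  then show False
    using \<open>0 < r\<close> open_not_negligible[of "ball a r"] by simp
qed

lemma hausdorff_outer_measure_singleton:
  assumes "0 < k"
  shows "hausdorff_outer_measure k {x} = 0"
proof -
  have "hausdorff_premeasure k \<delta> {x} \<le> 0" if "\<delta> \<in> {0<..}" for \<delta>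
  proof -
    have "hausdorff_cover \<delta> {x} (\<lambda>_. {x})"
      using that by (auto simp: hausdorff_cover_def)
    then have "hausdorff_premeasure k \<delta> {x} \<le> (\<Sum>i::nat. hausdorff_gauge k {x})"
      unfolding hausdorff_premeasure_def by (intro INF_lower) auto
    then show ?thesis
      using assms by (simp add: hausdorff_gauge_def zero_power)
  qed
  then have "hausdorff_outer_measure k {x} \<le> 0"
    unfolding hausdorff_outer_measure_def by (rule SUP_least)
  then show ?thesis
    by simp
qed

text \<open>
  The density vanishes only at the origin, because of the convention \<open>0 powr p = 0\<close>; a point has zero
  area only in dimension at least 2.
\<close>

lemma weighted_perimeter_zero_imp_frontier_null:
  fixes E :: "'a::euclidean_space set"
  assumes "2 \<le> DIM('a)" and zero: "weighted_perimeter p E = 0"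
  shows "hausdorff_outer_measure (DIM('a) - 1) (frontier E) = 0"
proof -
  let ?H = "hausdorff_measure (DIM('a) - 1) :: 'a measure"
  have [measurable]: "frontier E \<in> sets borel"
    by (intro borel_closed) auto
  have "AE x in ?H. ennreal (norm x powr p) * indicator (frontier E) x = 0"
    using zero unfolding weighted_perimeter_def
    by (subst (asm) nn_integral_0_iff_AE) measurable
  then have "AE x in ?H. x \<notin> frontier E - {0}"
    by eventually_elim (auto simp: indicator_def split: if_splits)
  moreover have "frontier E - {0} \<in> sets borel"
    by (intro sets.Diff borel_closed) auto
  ultimately have "emeasure ?H (frontier E - {0}) = 0"
    by (subst (asm) AE_iff_measurable[of "frontier E - {0}"]) auto
  then have "hausdorff_outer_measure (DIM('a) - 1) (frontier E - {0}) = 0"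
    using \<open>frontier E - {0} \<in> sets borel\<close> by (simp add: emeasure_hausdorff_measure)
  moreover have "hausdorff_outer_measure (DIM('a) - 1) (frontier E) \<le>
      hausdorff_outer_measure (DIM('a) - 1) (frontier E - {0}) + hausdorff_outer_measure (DIM('a) - 1) {0 :: 'a}"
    by (rule order_trans[OF _ hausdorff_outer_measure_subadditive]) (intro hausdorff_outer_measure_mono, auto)
  ultimately show ?thesis
    using assms by (simp add: hausdorff_outer_measure_singleton)
qed

section \<open>Weighted volume\<close>

lemma weighted_volume_alt:
  fixes E :: "'a::euclidean_space set"
  assumes "E \<in> sets lebesgue"
  shows "weighted_volume p E = emeasure (density lebesgue (\<lambda>x. ennreal (norm x powr p))) E"
proof -
  have "(\<lambda>x::'a. ennreal (norm x powr p)) \<in> borel_measurable lebesgue"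
    by (rule measurable_completion) measurable
  then show ?thesis
    using assms unfolding weighted_volume_def by (simp only: emeasure_density)
qed

lemma weighted_volume_Un:
  assumes "A \<in> sets lebesgue" "B \<in> sets lebesgue" "A \<inter> B = {}"
  shows "weighted_volume p (A \<union> B) = weighted_volume p A + weighted_volume p B"
  using assms by (simp add: weighted_volume_alt plus_emeasure)

lemma weighted_volume_le:
  fixes E :: "'a::euclidean_space set"
  assumes E: "E \<in> sets lebesgue" and a: "0 < a" "\<And>x. x \<in> E \<Longrightarrow> a \<le> norm x" and p: "p < 0"
  shows "weighted_volume p E \<le> ennreal (a powr p) * emeasure lebesgue E"
proof -
  have "weighted_volume p E \<le> (\<integral>\<^sup>+ x\<in>E. ennreal (a powr p) \<partial>lebesgue)"
    unfolding weighted_volume_def using a p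
    by (intro nn_integral_mono) (auto simp: indicator_def intro!: ennreal_leI powr_mono2')
  then show ?thesis
    using E by (simp add: nn_integral_cmult_indicator)
qed

lemma weighted_volume_ge:
  fixes E :: "'a::euclidean_space set"
  assumes E: "E \<in> sets lebesgue" and b: "\<And>x. x \<in> E \<Longrightarrow> 0 < norm x \<and> norm x \<le> b" and p: "p < 0"
  shows "ennreal (b powr p) * emeasure lebesgue E \<le> weighted_volume p E"
proof -
  have "(\<integral>\<^sup>+ x\<in>E. ennreal (b powr p) \<partial>lebesgue) \<le> weighted_volume p E"
    unfolding weighted_volume_def using b p
    by (intro nn_integral_mono) (auto simp: indicator_def intro!: ennreal_leI powr_mono2')
  then show ?thesis
    using E by (simp add: nn_integral_cmult_indicator)
qed

lemma emeasure_lebesgue_ball: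
  fixes c :: "'a::euclidean_space"
  shows "0 \<le> s \<Longrightarrow> emeasure lebesgue (ball c s) = ennreal (unit_ball_vol (real DIM('a)) * s ^ DIM('a))"
  by (subst emeasure_completion) (simp_all add: emeasure_ball)

lemma emeasure_lebesgue_ball_diff:
  fixes c :: "'a::euclidean_space"
  assumes "0 \<le> s" "s \<le> t"
  shows "emeasure lebesgue (ball c t - ball c s)
    = ennreal (unit_ball_vol (real DIM('a)) * t ^ DIM('a) - unit_ball_vol (real DIM('a)) * s ^ DIM('a))"
proof -
  have "emeasure lebesgue (ball c t - ball c s) = emeasure lebesgue (ball c t) - emeasure lebesgue (ball c s)"
    using assms by (intro emeasure_Diff) (auto simp: emeasure_ball subset_ball)
  then show ?thesis
    using assms by (simp only: emeasure_lebesgue_ball order_trans[OF assms] ennreal_minus) (simp add: ennreal_minus)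
qed

text \<open>
  Volumes are prescribed by continuity in the radius. Away from \<open>ball 0 a\<close> the density is at most
  \<open>a powr p\<close>, so the increments of the weighted volume are bounded by those of \<open>a powr p\<close> times the
  Euclidean volume of the ball, and the intermediate value theorem applies. Keeping the ball around
  the origin out of the region allows both annuli (\<open>c = 0\<close>) and balls far from the origin.
\<close>

lemma exists_ball_diff_weighted_volume:
  fixes c :: "'a::euclidean_space"
  assumes a: "0 < a" and b: "0 \<le> b" and p: "p < 0" and V: "0 \<le> V"
    and le: "ennreal V \<le> weighted_volume p (ball c b - ball 0 a)"
  obtains t where "0 \<le> t" "t \<le> b" "weighted_volume p (ball c t - ball 0 a) = ennreal V"
proof -
  let ?\<nu> = "density lebesgue (\<lambda>x::'a. ennreal (norm x powr p))"
  define M where "M t = ball c t - ball 0 a" for t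
  define g where "g t = weighted_volume p (M t)" for t
  define h where "h t = a powr p * (unit_ball_vol (real DIM('a)) * t ^ DIM('a))" for t :: real
  have M: "M t \<in> sets lebesgue" for t
    by (simp add: M_def)
  have step: "g s \<le> g t \<and> g t \<le> g s + ennreal (h t - h s)" if st: "0 \<le> s" "s \<le> t" for s t
  proof -
    have "M t = M s \<union> (M t - M s)"
      using subset_ball[OF st(2), of c] by (auto simp: M_def)
    then have "g t = weighted_volume p (M s \<union> (M t - M s))"
      by (simp only: g_def)
    also have "\<dots> = g s + weighted_volume p (M t - M s)"
      using M by (subst weighted_volume_Un) (auto simp: g_def)
    finally have g_eq: "g t = g s + weighted_volume p (M t - M s)" .
    have "weighted_volume p (M t - M s) \<le> ennreal (a powr p) * emeasure lebesgue (M t - M s)"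
      using a p M by (intro weighted_volume_le) (auto simp: M_def)
    also have "ennreal (a powr p) * emeasure lebesgue (M t - M s) \<le> ennreal (a powr p) * emeasure lebesgue (ball c t - ball c s)"
      by (intro mult_left_mono emeasure_mono) (auto simp: M_def)
    also have "ennreal (a powr p) * emeasure lebesgue (ball c t - ball c s) = ennreal (h t - h s)"
      by (subst emeasure_lebesgue_ball_diff[OF st]) (simp add: h_def right_diff_distrib flip: ennreal_mult')
    finally show ?thesis
      using g_eq by (simp add: add_left_mono mult_left_mono)
  qed
  have g0: "g 0 = 0"
    by (simp add: g_def M_def weighted_volume_def)
  have fin: "g t = ennreal (enn2real (g t))" if "0 \<le> t" for t
  proof -
    have "g t \<le> ennreal (h t - h 0)"
      using step[of 0 t] that g0 by simp
    then show ?thesis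
      by (metis ennreal_enn2real ennreal_less_top le_less_trans)
  qed
  have real_step: "\<bar>enn2real (g t) - enn2real (g s)\<bar> \<le> \<bar>h t - h s\<bar>" if "0 \<le> s" "0 \<le> t" for s t
  proof -
    have *: "\<bar>enn2real (g t) - enn2real (g s)\<bar> \<le> \<bar>h t - h s\<bar>" if st: "0 \<le> s" "s \<le> t" for s t
    proof -
      have hst: "h s \<le> h t"
        using st unfolding h_def by (intro mult_left_mono power_mono) auto
      have "ennreal (enn2real (g s)) \<le> ennreal (enn2real (g t))"
        "ennreal (enn2real (g t)) \<le> ennreal (enn2real (g s) + (h t - h s))"
        using step[OF st] hst fin[of s] fin[of t] st by (auto simp only: ennreal_plus enn2real_nonneg diff_ge_0_iff_ge)
      then have "enn2real (g s) \<le> enn2real (g t)" "enn2real (g t) \<le> enn2real (g s) + (h t - h s)"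
        using hst by (simp_all only: ennreal_le_iff enn2real_nonneg add_nonneg_nonneg diff_ge_0_iff_ge)
      then show ?thesis
        by linarith
    qed
    show ?thesis
      using *[of s t] *[of t s] that by linarith
  qed
  have "continuous_on {0..b} (\<lambda>t. enn2real (g t))"
  proof -
    have "continuous_on {0..b} h"
      unfolding h_def by (intro continuous_intros)
    then show ?thesis
      unfolding continuous_on_iff dist_real_def
    proof (intro ballI allI impI)
      fix s e :: real
      assume s: "s \<in> {0..b}" and "0 < e" and
        cont: "\<forall>x\<in>{0..b}. \<forall>e>0. \<exists>d>0. \<forall>x'\<in>{0..b}. \<bar>x' - x\<bar> < d \<longrightarrow> \<bar>h x' - h x\<bar> < e"
      then obtain d where d: "0 < d" "\<And>t. t \<in> {0..b} \<Longrightarrow> \<bar>t - s\<bar> < d \<Longrightarrow> \<bar>h t - h s\<bar> < e"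
        by blast
      have "\<bar>enn2real (g t) - enn2real (g s)\<bar> < e" if "t \<in> {0..b}" "\<bar>t - s\<bar> < d" for t
        using real_step[of s t] d(2)[OF that] s that(1) by (auto intro: le_less_trans)
      then show "\<exists>d>0. \<forall>t\<in>{0..b}. \<bar>t - s\<bar> < d \<longrightarrow> \<bar>enn2real (g t) - enn2real (g s)\<bar> < e"
        using d(1) by blast
    qed
  qed
  moreover have "V \<le> enn2real (g b)"
  proof -
    have "ennreal V \<le> ennreal (enn2real (g b))"
      using le unfolding fin[OF b, symmetric] by (simp only: g_def M_def)
    then show ?thesis
      by (simp only: ennreal_le_iff enn2real_nonneg)
  qed
  ultimately obtain t where t: "0 \<le> t" "t \<le> b" "enn2real (g t) = V"
    using IVT'[of "\<lambda>t. enn2real (g t)" 0 V b] g0 V b by auto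
  have "g t = ennreal V"
    using fin[OF t(1)] unfolding t(3) .
  then show ?thesis
    using that[OF t(1,2)] by (simp only: g_def M_def)
qed

text \<open>
  For \<open>p \<ge> -n\<close> each dyadic annulus outside the unit ball has weighted volume bounded below by one fixed
  positive constant, since its Euclidean volume is of order \<open>r\<^sup>n\<close> and \<open>r powr p * r\<^sup>n \<ge> 1\<close> for \<open>r \<ge> 1\<close>. The
  bound does not depend on the inner radius \<open>b\<close>, which can therefore be chosen large beforehand.
\<close>

lemma weighted_volume_annulus_ge:
  assumes p: "- real DIM('a::euclidean_space) \<le> p" "p < 0" and b: "1 \<le> b"
  shows "ennreal (real N * (2 powr p * unit_ball_vol (real DIM('a)) * (2 ^ DIM('a) - 1)))
    \<le> weighted_volume p (ball (0::'a) (2 ^ N * b) - ball 0 b)"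
proof (induction N)
  case (Suc N)
  let ?n = "DIM('a)"
  let ?\<omega> = "unit_ball_vol (real ?n)"
  let ?c = "2 powr p * ?\<omega> * (2 ^ ?n - 1)"
  define r where "r = 2 ^ N * b"
  have r: "1 \<le> r" "b \<le> r"
    using b one_le_power[of "2::real" N] mult_mono[of 1 "2 ^ N" 1 b] mult_right_mono[of 1 "2 ^ N" b]
    unfolding r_def by auto
  let ?A = "ball (0::'a) (2 * r) - ball 0 r"
  have "?c \<le> (2 * r) powr p * (?\<omega> * (2 * r) ^ ?n - ?\<omega> * r ^ ?n)"
  proof -
    have "r powr (- real ?n) \<le> r powr p"
      using r p by (intro powr_mono) auto
    then have "1 \<le> r powr p * r ^ ?n"
      using r by (simp add: powr_minus powr_realpow field_simps)
    then have "?c * 1 \<le> ?c * (r powr p * r ^ ?n)"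
      by (intro mult_left_mono) auto
    also have "\<dots> = (2 * r) powr p * (?\<omega> * (2 * r) ^ ?n - ?\<omega> * r ^ ?n)"
      using r by (simp add: powr_mult power_mult_distrib algebra_simps)
    finally show ?thesis by simp
  qed
  then have "ennreal ?c \<le> ennreal ((2 * r) powr p) * emeasure lebesgue ?A"
    using r by (subst emeasure_lebesgue_ball_diff) (simp_all add: ennreal_leI flip: ennreal_mult')
  also have "\<dots> \<le> weighted_volume p ?A"
    using r p by (intro weighted_volume_ge) auto
  finally have A: "ennreal ?c \<le> weighted_volume p ?A" .
  have split: "ball (0::'a) (2 ^ Suc N * b) - ball 0 b = (ball 0 r - ball 0 b) \<union> ?A"
    using r unfolding r_def by auto
  have "ennreal (real (Suc N) * ?c) = ennreal (real N * ?c) + ennreal ?c"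
    by (subst ennreal_plus[symmetric]) (simp_all add: distrib_right add.commute)
  also have "\<dots> \<le> weighted_volume p (ball (0::'a) r - ball 0 b) + weighted_volume p ?A"
    using Suc A unfolding r_def by (intro add_mono)
  also have "\<dots> = weighted_volume p (ball (0::'a) (2 ^ Suc N * b) - ball 0 b)"
    unfolding split by (rule weighted_volume_Un[symmetric]) auto
  finally show ?case .
qed simp

lemma exists_weighted_volume_annulus_ge:
  assumes "- real DIM('a::euclidean_space) \<le> p" "p < 0" "1 \<le> b"
  obtains N where "ennreal V \<le> weighted_volume p (ball (0::'a) (2 ^ N * b) - ball 0 b)"
proof -
  let ?c = "2 powr p * unit_ball_vol (real DIM('a)) * (2 ^ DIM('a) - 1)"
  have "0 < ?c"
    by (intro mult_pos_pos) auto
  then obtain N where "V < real N * ?c"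
    using reals_Archimedean3 by blast
  then have "ennreal V \<le> ennreal (real N * ?c)"
    by (intro ennreal_leI) auto
  then show ?thesis
    using weighted_volume_annulus_ge[OF assms, of N] that order_trans by blast
qed

text \<open>
  Up to a null set, \<open>E\<close> contains arbitrarily many disjoint dyadic annuli, each of weighted volume bounded
  below by the same constant.
\<close>

lemma weighted_volume_conegligible:
  fixes E :: "'a::euclidean_space set"
  assumes p: "- real DIM('a) \<le> p" "p < 0" and E: "negligible (- E)"
  shows "weighted_volume p E = \<infinity>"
proof -
  have large: "ennreal V \<le> weighted_volume p E" for V
  proof -
    obtain N where N: "ennreal V \<le> weighted_volume p (ball (0::'a) (2 ^ N * 1) - ball 0 1)"
      using exists_weighted_volume_annulus_ge[OF p, of 1 V] by auto
    have "AE x in lebesgue. x \<in> E"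
      using E by (intro AE_I'[of "- E"]) (auto simp: negligible_iff_null_sets)
    then have "weighted_volume p (ball (0::'a) (2 ^ N * 1) - ball 0 1) \<le> weighted_volume p E"
      unfolding weighted_volume_def
      by (intro nn_integral_mono_AE) (auto elim!: eventually_mono simp: indicator_def)
    with N show ?thesis
      by simp
  qed
  show ?thesis
  proof (cases "weighted_volume p E")
      case (real r)
      then have "ennreal (r + 1) \<le> ennreal r"
        using large[of "r + 1"] by simp
      then show ?thesis
        using real by (simp add: ennreal_le_iff)
    qed simp
qed

section \<open>Regions of small perimeter\<close>

lemma sphere_weighted_area_le:
  fixes c :: "'a::euclidean_space"
  assumes "0 < a" "0 < s" "p < 0" and far: "\<And>x. x \<in> sphere c s \<Longrightarrow> a \<le> norm x"
  shows "(\<integral>\<^sup>+ x\<in>sphere c s. ennreal (norm x powr p) \<partial>hausdorff_measure (DIM('a) - 1)) \<le>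
    ennreal (unit_ball_vol (real (DIM('a) - 1)) * real DIM('a) * 4 ^ DIM('a) * a powr p * s ^ (DIM('a) - 1))"
proof -
  let ?H = "hausdorff_measure (DIM('a) - 1) :: 'a measure"
  let ?C = "unit_ball_vol (real (DIM('a) - 1)) * real DIM('a) * 4 ^ DIM('a) * s ^ (DIM('a) - 1)"
  have "(\<integral>\<^sup>+ x\<in>sphere c s. ennreal (norm x powr p) \<partial>?H) \<le> (\<integral>\<^sup>+ x\<in>sphere c s. ennreal (a powr p) \<partial>?H)"
    using assms by (intro nn_integral_mono) (auto simp: indicator_def intro!: ennreal_leI powr_mono2')
  also have "\<dots> = ennreal (a powr p) * emeasure ?H (sphere c s)"
    by (intro nn_integral_cmult_indicator) auto
  also have "\<dots> \<le> ennreal (a powr p) * ennreal ?C"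
    using hausdorff_outer_measure_sphere_le[OF assms(2), of c]
    by (intro mult_left_mono) (auto simp: emeasure_hausdorff_measure)
  also have "\<dots> = ennreal (a powr p * ?C)"
    by (simp flip: ennreal_mult')
  finally show ?thesis
    by (simp add: mult_ac)
qed

lemma weighted_perimeter_ball_diff_le:
  fixes c :: "'a::euclidean_space"
  assumes "0 < a" "0 < t"
  defines "H \<equiv> hausdorff_measure (DIM('a) - 1) :: 'a measure"
  shows "weighted_perimeter p (ball c t - ball 0 a) \<le>
    (\<integral>\<^sup>+ x\<in>sphere c t. ennreal (norm x powr p) \<partial>H) + (\<integral>\<^sup>+ x\<in>sphere 0 a. ennreal (norm x powr p) \<partial>H)"
proof -
  have [measurable_cong]: "sets H = sets borel"
    by (simp add: H_def)
  have [measurable]: "sphere y r \<in> sets borel" for y :: 'a and r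
    by (intro borel_closed) auto
  have fr: "frontier (ball c t - ball 0 a) \<subseteq> sphere c t \<union> sphere 0 a"
    using assms frontier_Int_subset[of "ball c t" "- ball 0 a"] by (simp add: Diff_eq)
  have "weighted_perimeter p (ball c t - ball 0 a) \<le>
    (\<integral>\<^sup>+ x. ennreal (norm x powr p) * indicator (sphere c t) x + ennreal (norm x powr p) * indicator (sphere 0 a) x \<partial>H)"
    unfolding weighted_perimeter_def H_def[symmetric]
    using fr by (intro nn_integral_mono) (auto simp: indicator_def)
  also have "\<dots> = (\<integral>\<^sup>+ x\<in>sphere c t. ennreal (norm x powr p) \<partial>H) + (\<integral>\<^sup>+ x\<in>sphere 0 a. ennreal (norm x powr p) \<partial>H)"
    by (intro nn_integral_add) measurable
  finally show ?thesis .
qed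

text \<open>
  For \<open>p = -n\<close> the weighted volume is invariant under dilation, so a region of the prescribed volume can
  be taken arbitrarily far out: an annulus of inner radius \<open>a\<close>. The weighted area of a centred sphere of
  radius \<open>r\<close> is of order \<open>1/r\<close>. Balls away from the origin would not do so simply: for large \<open>V\<close> they
  would have to come close to the origin on the scale of their own radius.
\<close>

lemma exists_small_perimeter_critical:
  assumes p: "p = - real DIM('a::euclidean_space)" and V: "0 < V" and \<epsilon>: "0 < \<epsilon>"
  shows "\<exists>E \<in> sets (lebesgue :: 'a measure). weighted_volume p E = ennreal V \<and> weighted_perimeter p E < ennreal \<epsilon>"
proof -
  define C where "C = unit_ball_vol (real (DIM('a) - 1)) * real DIM('a) * 4 ^ DIM('a)"
  have C: "0 \<le> C"
    by (simp add: C_def)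
  have p0: "p < 0"
    by (simp add: p)
  \<comment> \<open>The two boundary spheres of the annulus contribute at most \<open>C / a\<close> each.\<close>
  define a where "a = 1 + 2 * C / \<epsilon>"
  have a: "1 \<le> a" "2 * C < \<epsilon> * a"
    using C \<epsilon> by (auto simp: a_def field_simps)
  obtain N where N: "ennreal V \<le> weighted_volume p (ball (0::'a) (2 ^ N * a) - ball 0 a)"
    using exists_weighted_volume_annulus_ge[OF _ p0 a(1), of V, where 'a = 'a] p by auto
  obtain t where t: "0 \<le> t" and vol: "weighted_volume p (ball (0::'a) t - ball 0 a) = ennreal V"
    using exists_ball_diff_weighted_volume[OF _ _ p0 _ N] a V by auto
  have "a < t"
  proof (rule ccontr)
    assume "\<not> a < t"
    then have empty: "ball (0::'a) t - ball 0 a = {}"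
      by auto
    show False
      using vol V unfolding empty by (simp add: weighted_volume_def)
  qed
  have area: "(\<integral>\<^sup>+ x\<in>sphere (0::'a) r. ennreal (norm x powr p) \<partial>hausdorff_measure (DIM('a) - 1)) \<le> ennreal (C / a)"
    if r: "a \<le> r" for r
  proof -
    have "r powr p * r ^ (DIM('a) - 1) = 1 / r"
    proof -
      have "r powr p * r ^ (DIM('a) - 1) = r powr (p + real (DIM('a) - 1))"
        using r a by (simp add: powr_add powr_realpow del: of_nat_diff)
      also have "p + real (DIM('a) - 1) = -1"
        by (simp add: p of_nat_diff Suc_leI)
      finally show ?thesis
        using r a by (simp add: powr_minus_divide)
    qed
    then have "C * r powr p * r ^ (DIM('a) - 1) = C / r"
      by (simp add: mult.assoc)
    also have "\<dots> \<le> C / a"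
      using r a C by (intro divide_left_mono) auto
    finally show ?thesis
      using sphere_weighted_area_le[of r r p "0::'a"] r a p0
      by (auto simp: C_def intro: order_trans ennreal_leI)
  qed
  have "weighted_perimeter p (ball (0::'a) t - ball 0 a) \<le> ennreal (C / a) + ennreal (C / a)"
    using weighted_perimeter_ball_diff_le[of a t p "0::'a"] a \<open>a < t\<close> area[of t] area[of a]
    by (intro order_trans[OF weighted_perimeter_ball_diff_le] add_mono) auto
  also have "\<dots> = ennreal (2 * C / a)"
    using C a by (subst ennreal_plus[symmetric]) auto
  also have "\<dots> < ennreal \<epsilon>"
    using a \<epsilon> by (intro ennreal_lessI) (auto simp: field_simps)
  finally show ?thesis
    using vol by (intro bexI[of _ "ball 0 t - ball 0 a"]) auto
qed

lemma powr_eventually_gt: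
  fixes q X :: real
  assumes "0 < q"
  obtains A where "1 \<le> A" "\<And>a. A \<le> a \<Longrightarrow> X < a powr q"
proof
  let ?Y = "\<bar>X\<bar> + 1"
  show "1 \<le> ?Y powr (1 / q)"
    using assms by (intro ge_one_powr_ge_zero) auto
  fix a assume "?Y powr (1 / q) \<le> a"
  then have "(?Y powr (1 / q)) powr q \<le> a powr q"
    using assms by (intro powr_mono2) auto
  then show "X < a powr q"
    using assms by (simp add: powr_powr)
qed

text \<open>
  For \<open>p > -n\<close> a ball of radius \<open>a\<close> at distance \<open>2 a\<close> from the origin has weighted volume of order
  \<open>a powr (n + p)\<close>, which exceeds \<open>V\<close> for large \<open>a\<close>. Shrinking it to volume \<open>V\<close> leaves a ball of radius \<open>t\<close> on
  which the density is comparable to \<open>a powr p\<close>. Thus \<open>t\<^sup>n\<close> is of order \<open>a powr -p\<close>, which tends to infinity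
  because \<open>p < 0\<close>, and the weighted perimeter is of order \<open>V / t\<close>. Annuli fail here: their area, of order
  \<open>a powr (n - 1 + p)\<close>, need not be small.
\<close>

lemma exists_small_perimeter_supercritical:
  assumes p: "- real DIM('a::euclidean_space) < p" "p < 0" and V: "0 < V" and \<epsilon>: "0 < \<epsilon>"
  shows "\<exists>E \<in> sets (lebesgue :: 'a measure). weighted_volume p E = ennreal V \<and> weighted_perimeter p E < ennreal \<epsilon>"
proof -
  let ?n = "DIM('a)"
  define C where "C = unit_ball_vol (real (?n - 1)) * real ?n * 4 ^ ?n"
  define \<omega> where "\<omega> = unit_ball_vol (real ?n)"
  have C: "0 \<le> C" and \<omega>: "0 < \<omega>"
    by (simp_all add: C_def \<omega>_def)
  \<comment> \<open>The perimeter will be at most \<open>C V / (3 powr p * \<omega> t)\<close>, so a radius above \<open>L\<close> suffices.\<close>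
  define L where "L = C * V / (3 powr p * \<omega> * \<epsilon>)"
  have L: "0 \<le> L"
    using C V \<omega> \<epsilon> by (simp add: L_def)
  obtain A1 where A1: "1 \<le> A1" "\<And>a. A1 \<le> a \<Longrightarrow> V / (3 powr p * \<omega>) < a powr (real ?n + p)"
    using powr_eventually_gt[of "real ?n + p"] p by auto
  obtain A2 where A2: "1 \<le> A2" "\<And>a. A2 \<le> a \<Longrightarrow> L ^ ?n * \<omega> / V < a powr (- p)"
    using powr_eventually_gt[of "- p"] p by auto
  define a where "a = max A1 A2"
  have a: "1 \<le> a" "V / (3 powr p * \<omega>) < a powr (real ?n + p)" "L ^ ?n * \<omega> / V < a powr (- p)"
    using A1 A2 by (auto simp: a_def)
  obtain u :: 'a where u: "u \<in> Basis"
    using nonempty_Basis by blast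
  define c where "c = (2 * a) *\<^sub>R u"
  have norms: "a \<le> norm x \<and> norm x \<le> 3 * a" if "dist c x \<le> a" for x
  proof -
    have "norm c = 2 * a"
      using u a by (simp add: c_def)
    then show ?thesis
      using that norm_triangle_ineq2[of c x] norm_triangle_ineq2[of x c]
      by (auto simp: dist_norm norm_minus_commute)
  qed
  have diff: "ball c t - ball 0 a = ball c t" if "t \<le> a" for t
  proof -
    have "x \<notin> ball 0 a" if "x \<in> ball c t" for x
      using norms[of x] that \<open>t \<le> a\<close> by simp
    then show ?thesis
      by blast
  qed
  have meas_ball: "emeasure lebesgue (ball c t) = ennreal (\<omega> * t ^ ?n)" if "0 \<le> t" for t
    using emeasure_lebesgue_ball[OF that, of c] by (simp add: \<omega>_def)
  have lower: "ennreal ((3 * a) powr p * (\<omega> * t ^ ?n)) \<le> weighted_volume p (ball c t)" if "0 \<le> t" "t \<le> a" for t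
  proof -
    have "0 < norm x \<and> norm x \<le> 3 * a" if "x \<in> ball c t" for x
      using norms[of x] that \<open>t \<le> a\<close> a(1) by auto
    then have "ennreal ((3 * a) powr p) * emeasure lebesgue (ball c t) \<le> weighted_volume p (ball c t)"
      using p by (intro weighted_volume_ge) auto
    then show ?thesis
      using that \<omega> by (simp only: meas_ball) (simp add: ennreal_mult')
  qed
  have "V \<le> (3 * a) powr p * (\<omega> * a ^ ?n)"
  proof -
    have "V \<le> 3 powr p * \<omega> * a powr (real ?n + p)"
      using a(2) \<omega> by (simp add: field_simps)
    also have "\<dots> = (3 * a) powr p * (\<omega> * a ^ ?n)"
      using a(1) by (simp add: powr_add powr_mult powr_realpow mult_ac)
    finally show ?thesis .
  qed
  then have "ennreal V \<le> weighted_volume p (ball c a - ball 0 a)"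
    using lower[of a] a(1) diff[of a] by (auto intro: order_trans ennreal_leI)
  then obtain t where t: "0 \<le> t" "t \<le> a" and "weighted_volume p (ball c t - ball 0 a) = ennreal V"
    using exists_ball_diff_weighted_volume[of a a p V c] a(1) p V by auto
  then have vol: "weighted_volume p (ball c t) = ennreal V"
    using diff by simp
  have upper: "V \<le> a powr p * (\<omega> * t ^ ?n)"
  proof -
    have "weighted_volume p (ball c t) \<le> ennreal (a powr p) * emeasure lebesgue (ball c t)"
      using norms t a p by (intro weighted_volume_le) (auto dest!: less_imp_le intro: order_trans)
    then have "ennreal V \<le> ennreal (a powr p * (\<omega> * t ^ ?n))"
      using t \<omega> unfolding vol by (simp only: meas_ball) (simp add: ennreal_mult')
    then show ?thesis
      using t \<omega> by (subst (asm) ennreal_le_iff) auto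
  qed
  have "L ^ ?n < t ^ ?n"
  proof -
    have "L ^ ?n * \<omega> * a powr p < V"
      using a(1,3) V by (simp add: powr_minus field_simps)
    then have "(a powr p * \<omega>) * L ^ ?n < (a powr p * \<omega>) * t ^ ?n"
      using upper by (simp add: mult_ac)
    then show ?thesis
      using a(1) \<omega> by (subst (asm) mult_less_cancel_left_pos) auto
  qed
  then have Lt: "L < t"
    using t(1) by (rule power_less_imp_less_base)
  have "weighted_perimeter p (ball c t) \<le> ennreal (C * a powr p * t ^ (?n - 1))"
    using sphere_weighted_area_le[of a t p c] norms t Lt L a(1) p
    by (simp add: weighted_perimeter_def C_def)
  also have "\<dots> < ennreal \<epsilon>"
  proof (rule ennreal_lessI)
    have "3 powr p * \<omega> * (a powr p * t ^ (?n - 1)) * t = (3 * a) powr p * (\<omega> * t ^ ?n)"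
      using a(1) by (cases ?n) (auto simp: powr_mult mult_ac)
    also have "\<dots> \<le> V"
      using lower[OF t] V unfolding vol by (subst (asm) ennreal_le_iff) auto
    finally have "C * (3 powr p * \<omega> * (a powr p * t ^ (?n - 1)) * t) \<le> C * V"
      using C by (intro mult_left_mono)
    also have "C * V = L * (3 powr p * \<omega> * \<epsilon>)"
      using \<omega> \<epsilon> by (simp add: L_def)
    also have "\<dots> < t * (3 powr p * \<omega> * \<epsilon>)"
      using Lt \<omega> \<epsilon> by (intro mult_strict_right_mono) auto
    finally have "(3 powr p * \<omega> * t) * (C * a powr p * t ^ (?n - 1)) < (3 powr p * \<omega> * t) * \<epsilon>"
      by (simp only: mult_ac)
    then show "C * a powr p * t ^ (?n - 1) < \<epsilon>"
      using \<omega> Lt L by (subst (asm) mult_less_cancel_left_pos) auto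
  qed (use \<epsilon> in auto)
  finally show ?thesis
    using vol by (intro bexI[of _ "ball c t"]) auto
qed


section \<open>Nonexistence of isoperimetric regions\<close>

theorem proposition7p3:
  fixes p :: real
  assumes "2 \<le> DIM('a::euclidean_space)"
    and "- real DIM('a) \<le> p" and "p < 0"
  shows "(\<nexists>E :: 'a set. isoperimetric_region p E) \<and>
    (\<forall>V > (0::real). \<forall>\<epsilon> > (0::real). \<exists>E \<in> sets (lebesgue :: 'a measure).
       weighted_volume p E = ennreal V \<and> weighted_perimeter p E < ennreal \<epsilon>)"
proof -
  have cheap: "\<exists>E \<in> sets (lebesgue :: 'a measure).
      weighted_volume p E = ennreal V \<and> weighted_perimeter p E < ennreal \<epsilon>" if "0 < V" "0 < \<epsilon>" for V \<epsilon>
    using exists_small_perimeter_critical[where 'a = 'a, of p V \<epsilon>]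
      exists_small_perimeter_supercritical[where 'a = 'a, of p V \<epsilon>] that assms
    by (cases "p = - real DIM('a)") auto
  have "\<not> isoperimetric_region p E" for E :: "'a set"
  proof
    assume "isoperimetric_region p E"
    then have E: "E \<in> sets lebesgue" "0 < weighted_volume p E" "weighted_volume p E < \<infinity>"
      and min: "\<And>F :: 'a set. F \<in> sets lebesgue \<Longrightarrow> weighted_volume p F = weighted_volume p E \<Longrightarrow>
        weighted_perimeter p E \<le> weighted_perimeter p F"
      by (auto simp: isoperimetric_region_def)
    obtain V where V: "0 < V" "weighted_volume p E = ennreal V"
      using E by (cases "weighted_volume p E") auto
    have "weighted_perimeter p E \<le> 0 + ennreal \<epsilon>" if pos: "0 < \<epsilon>" for \<epsilon>
    proof -
      obtain F :: "'a set" where "F \<in> sets lebesgue" "weighted_volume p F = ennreal V"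
        "weighted_perimeter p F < ennreal \<epsilon>"
        using cheap[OF V(1) pos] by blast
      then show ?thesis
        using min[of F] V(2) by simp
    qed
    then have "weighted_perimeter p E \<le> 0"
      using ennreal_le_epsilon[of 0 "weighted_perimeter p E"] by blast
    then have "weighted_perimeter p E = 0"
      by simp
    then have null: "hausdorff_outer_measure (DIM('a) - 1) (frontier E) = 0"
      by (rule weighted_perimeter_zero_imp_frontier_null[OF assms(1)])
    then consider "negligible E" | "negligible (- E)"
      using frontier_null_imp_negligible_or_conegligible[OF null] by blast
    then show False
    proof cases
      case 1
      then have "weighted_volume p E = 0"
        unfolding weighted_volume_def negligible_iff_null_sets by (rule nn_integral_null_set)
      with E(2) show False
        by simp
    next
      case 2
      then have "weighted_volume p E = \<infinity>"
        by (rule weighted_volume_conegligible[OF assms(2,3)])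
      with E(3) show False
        by simp
    qed
  qed
  with cheap show ?thesis
    by blast
qed

end
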